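(* Suppose $k\geq 2$ and $n\geq 2$ are integers and $m$ is the period of an $\mathcal{OS}_k(n)$ (a $k$-ary orientable sequence of order $n$). (i) If $n=2$ then $m \leq \frac{k^2-k}{2}$ if $k$ is odd, and $m\leq \frac{k^2-2k}{2}$ if $k$ is even. (ii) If $n=3$ then $m \leq \frac{k^3-k^2}{2}$ if $k$ is odd, and $m\leq \frac{k^3-k^2-2k}{2}$ if $k$ is even. (iii) If $n=4$ then $m \leq \frac{k^4-3k^2+2k}{2}$ if $k$ is odd, and $m\leq \frac{k^4-2k^2}{2}$ if $k$ is even. (iv) If $n>4$ then \[ m \leq \begin{cases} \frac{k^n-3k^{(n+1)/2}-2k^{(n-1)/2}+k^3+3k^2}{2}, & \text{if $n$ and $k$ are odd,} \\ \frac{k^n-3k^{(n+1)/2}+k^3+k^2-2k}{2}, & \text{if $n$ is odd and $k$ is even,} \\ \frac{k^n-5k^{n/2}+4k^2}{2}, & \text{if $n$ is even and $k$ is odd,} \\ \frac{k^n-3k^{n/2}+k^2-k}{2}, & \text{if $n$ and $k$ are even.} \end{cases}\]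
   Context: Let $k\ge 2$ and $n\ge 2$. For an infinite periodic sequence $S=(s_i)$ with elements in $\mathbb{Z}_k$, write $\mathbf{s}_n(i)=(s_i,s_{i+1},\ldots,s_{i+n-1})$. For an $n$-tuple $\mathbf{u}=(u_0,\ldots,u_{n-1})$ its reverse is $\mathbf{u}^R=(u_{n-1},\ldots,u_0)$. $S$, of period $m$, is a $k$-ary $n$-window sequence if $\mathbf{s}_n(i)=\mathbf{s}_n(j)$ implies $i\equiv j \pmod m$. A $k$-ary $n$-window sequence $S$ is an orientable sequence of order $n$, called an $\mathcal{OS}_k(n)$, if $\mathbf{s}_n(i)\neq \mathbf{s}_n(j)^R$ for all $i,j$ (including $i=j$). *)

theory Defs
  imports Complex_Main "HOL-Number_Theory.Cong"
begin

text \<open>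
  Sequences are indexed by the natural numbers, and the alphabet \<open>\<int>\<^sub>k\<close> is represented by the residues
  \<open>0, \<dots>, k - 1\<close> (only equality of symbols matters).
\<close>

definition seq_over :: "nat \<Rightarrow> (nat \<Rightarrow> nat) \<Rightarrow> bool" where
  "seq_over k S \<longleftrightarrow> (\<forall>i. S i < k)"

definition has_period :: "nat \<Rightarrow> (nat \<Rightarrow> nat) \<Rightarrow> bool" where
  "has_period m S \<longleftrightarrow> m > 0 \<and> (\<forall>i. S (i + m) = S i)"

definition window :: "nat \<Rightarrow> (nat \<Rightarrow> nat) \<Rightarrow> nat \<Rightarrow> nat list" where
  "window n S i = map S [i..<i + n]"

text \<open>
  \<^const>\<open>has_period\<close> does not ask for the least period; the window condition below forces it: if
  \<open>d\<close> is any positive period of \<open>S\<close>, then the windows at \<open>0\<close> and \<open>d\<close> agree, so \<open>m\<close> divides \<open>d\<close>.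
\<close>

definition window_sequence :: "nat \<Rightarrow> nat \<Rightarrow> nat \<Rightarrow> (nat \<Rightarrow> nat) \<Rightarrow> bool" where
  "window_sequence k n m S \<longleftrightarrow> seq_over k S \<and> has_period m S \<and>
     (\<forall>i j. window n S i = window n S j \<longrightarrow> [i = j] (mod m))"

definition orientable_sequence :: "nat \<Rightarrow> nat \<Rightarrow> nat \<Rightarrow> (nat \<Rightarrow> nat) \<Rightarrow> bool" where
  "orientable_sequence k n m S \<longleftrightarrow> window_sequence k n m S \<and>
     (\<forall>i j. window n S i \<noteq> rev (window n S j))"

end

theory Submission
  imports Defs
begin

text \<open>
  Let the \<open>k\<^sup>n\<close> tuples of length \<open>n\<close> be the edges of the de Bruijn graph, an edge \<open>u\<close> leading
  from the \<open>(n - 1)\<close>-tuple \<^term>\<open>butlast u\<close> to \<^term>\<open>tl u\<close>.  The \<open>m\<close> windows of an orientable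
  sequence form a closed walk without repeated edges, and the reversed windows form another one
  that is edge-disjoint from it.  So the union \<open>E\<close> has \<open>2 m\<close> edges, is closed under reversal and
  contains no palindrome.  If the walk visits the vertex \<open>v\<close> exactly \<open>N v\<close> times, then \<open>E\<close> has
  \<open>N v + N (rev v)\<close> edges leaving \<open>v\<close> (\<open>orientable_sequence_edge_set\<close>).  This out-degree is
  therefore the same at \<open>v\<close> and at \<open>rev v\<close>, and it is even when \<open>v\<close> is a palindrome.

  Besides the \<open>k\<^bsup>(n + 1) div 2\<^esup>\<close> palindromes, these two facts exclude further edges from \<open>E\<close>
  (\<open>forced_unused_edge\<close>).
  \<^item> Let \<open>v = w @ [x]\<close> with \<open>w\<close> a palindrome.  The palindrome \<open>x # w @ [x]\<close> leaves \<open>rev v\<close>, so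
    not all \<open>k\<close> edges at \<open>rev v\<close> are in \<open>E\<close>, hence not all \<open>k\<close> edges at \<open>v\<close>.  If no
    palindrome leaves \<open>v\<close>, the lost edge has not been counted yet.
  \<^item> Let \<open>v\<close> be a palindrome.  If \<open>v\<close> is not constant, none of its \<open>k\<close> out-edges is a palindrome;
    if it is constant, exactly one of them is.  An even number of them is used, so one more is lost
    when \<open>k\<close> is odd in the first case, and when \<open>k\<close> is even in the second.

  Choosing one lost edge at each of these forced vertices gives a set \<open>F\<close> of \<open>|D|\<close> unused edges,
  where \<open>D\<close> is the set of forced vertices, and the reversals of \<open>F\<close> are unused as well.  Hence
  \<open>|F \<union> rev ` F| = 2 |D| - |F \<inter> rev ` F|\<close> edges are lost, and \<open>F \<inter> rev ` F\<close> consists of edges \<open>u\<close> for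
  which \<^term>\<open>butlast u\<close> and \<^term>\<open>butlast (rev u)\<close> are both forced.  Such a \<open>u\<close> has a palindromic
  prefix and a palindromic suffix, each of length \<open>n - 2\<close> or \<open>n - 1\<close>; two overlapping reflections
  make \<open>u\<close> periodic with period at most 4, and so there are at most about \<open>k\<^sup>3\<close> such edges
  (\<open>card_pal_pair_odd\<close>, \<open>card_pal_pair_even\<close>).  For \<open>n = 2\<close> and \<open>n = 4\<close> the simpler inequality
  \<open>|F \<union> rev ` F| \<ge> |D|\<close> suffices; it is needed for \<open>n = 4\<close> and odd \<open>k\<close>, where the estimate of the
  overlap is as large as \<open>2 |D|\<close>.  For \<open>n = 3\<close> the palindromes alone account for the bound if
  \<open>k\<close> is odd, and there is no overlap if \<open>k\<close> is even.
\<close>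

section \<open>Tuples, palindromes and constant tuples\<close>

definition tuples :: "nat \<Rightarrow> nat \<Rightarrow> nat list set" where
  "tuples k n = {u. set u \<subseteq> {..<k} \<and> length u = n}"

definition palindrome :: "'a list \<Rightarrow> bool" where
  "palindrome u \<longleftrightarrow> rev u = u"

definition uniform :: "'a list \<Rightarrow> bool" where
  "uniform u \<longleftrightarrow> (\<exists>a. u = replicate (length u) a)"

lemma finite_tuples [simp]: "finite (tuples k n)"
  unfolding tuples_def by (rule finite_lists_length_eq) simp

lemma card_tuples: "card (tuples k n) = k ^ n"
  using card_lists_length_eq[of "{..<k}" n] by (simp add: tuples_def)

lemma tuples_rev [simp]: "rev u \<in> tuples k n \<longleftrightarrow> u \<in> tuples k n"
  by (simp add: tuples_def)

lemma palindrome_rev [simp]: "palindrome (rev u) \<longleftrightarrow> palindrome u"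
  by (auto simp: palindrome_def)

lemma palindrome_nth: "palindrome u \<Longrightarrow> i < length u \<Longrightarrow> u ! i = u ! (length u - Suc i)"
  by (metis palindrome_def rev_nth)

lemma uniform_palindrome: "uniform u \<Longrightarrow> palindrome u"
  by (metis uniform_def palindrome_def rev_replicate)

lemma uniform_take: "uniform u \<Longrightarrow> uniform (take i u)"
  by (metis uniform_def length_replicate take_replicate)

lemma uniform_drop: "uniform u \<Longrightarrow> uniform (drop i u)"
  by (metis uniform_def length_replicate drop_replicate)

lemma uniform_butlast: "uniform u \<Longrightarrow> uniform (butlast u)"
  by (simp add: butlast_conv_take uniform_take)

text \<open>
  The reflections of \<open>u\<close> and of \<^term>\<open>butlast u\<close> differ by a shift of one position, so consecutive
  symbols agree.
\<close>

lemma palindrome_butlast_uniform: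
  assumes "palindrome u" and "palindrome (butlast u)"
  shows "uniform u"
proof -
  have tl: "tl u = butlast u"
    using assms butlast_rev[of u] unfolding palindrome_def by (metis rev_rev_ident)
  have "u ! i = u ! 0" if "i < length u" for i
    using that
  proof (induction i)
    case (Suc i)
    have "u ! Suc i = tl u ! i" using Suc.prems by (simp add: nth_tl)
    also have "\<dots> = u ! i" using Suc.prems tl by (simp add: nth_butlast)
    finally show ?case using Suc by simp
  qed simp
  then have "u = replicate (length u) (u ! 0)" by (intro nth_equalityI) simp_all
  then show ?thesis unfolding uniform_def by blast
qed

lemma palindrome_Cons_snoc: "palindrome (x # u @ [y]) \<longleftrightarrow> x = y \<and> palindrome u"
  by (auto simp: palindrome_def)

lemma card_palindromes: "card {u \<in> tuples k n. palindrome u} = k ^ ((n + 1) div 2)"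
proof (induction n rule: induct_nat_012)
  case 0
  have "{u \<in> tuples k 0. palindrome u} = {[]}" by (auto simp: tuples_def palindrome_def)
  then show ?case by simp
next
  case 1
  have "{u \<in> tuples k (Suc 0). palindrome u} = tuples k 1"
    by (auto simp: tuples_def palindrome_def length_Suc_conv)
  then show ?case using card_tuples[of k 1] by simp
next
  case (ge2 n)
  let ?f = "\<lambda>(x, u). x # u @ [x :: nat]"
  have "{u \<in> tuples k (Suc (Suc n)). palindrome u}
      = ?f ` ({..<k} \<times> {u \<in> tuples k n. palindrome u})" (is "?L = ?R")
  proof (intro equalityI subsetI)
    fix u assume u: "u \<in> ?L"
    then obtain x v where "u = x # v" "length v = Suc n" by (auto simp: tuples_def length_Suc_conv)
    then obtain w y where "u = x # w @ [y]" "length w = n"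
      by (metis length_Suc_conv_rev)
    with u show "u \<in> ?R" by (auto simp: tuples_def palindrome_Cons_snoc image_iff)
  qed (auto simp: tuples_def palindrome_Cons_snoc)
  moreover have "inj_on ?f ({..<k} \<times> {u \<in> tuples k n. palindrome u})"
    by (auto simp: inj_on_def)
  ultimately have "card ?L = k * card {u \<in> tuples k n. palindrome u}"
    by (simp add: card_image card_cartesian_product)
  with ge2 show ?case by simp
qed

lemma card_uniform:
  assumes "n \<ge> 1"
  shows "card {u \<in> tuples k n. uniform u} = k"
proof -
  have "{u \<in> tuples k n. uniform u} = replicate n ` {..<k}"
  proof (intro equalityI subsetI)
    fix u assume "u \<in> {u \<in> tuples k n. uniform u}"
    then obtain a where "u = replicate n a" and "set u \<subseteq> {..<k}" 
      by (auto simp: tuples_def uniform_def)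
    with assms show "u \<in> replicate n ` {..<k}" by (cases n) auto
  qed (auto simp: tuples_def uniform_def)
  moreover have "inj_on (replicate n) {..<k}" using assms by (auto simp: inj_on_def)
  ultimately show ?thesis by (simp add: card_image)
qed

section \<open>Tuples with a palindromic prefix and a palindromic suffix\<close>

text \<open>
  The parameters \<open>p\<close> and \<open>q\<close> count the symbols left out: the palindromic prefix has length
  \<open>n - p\<close>, the palindromic suffix length \<open>n - q\<close>.  The two reflections compose to a shift by
  \<open>p + q\<close>, so these tuples have period \<open>p + q\<close>.
\<close>

definition pal_pair :: "nat \<Rightarrow> nat \<Rightarrow> nat \<Rightarrow> nat \<Rightarrow> nat list set" where
  "pal_pair k p q n = {u \<in> tuples k n. palindrome (take (n - p) u) \<and> palindrome (drop q u)}"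

lemma finite_pal_pair [simp]: "finite (pal_pair k p q n)"
  by (rule finite_subset[OF _ finite_tuples[of k n]]) (auto simp: pal_pair_def)

lemma card_pal_pair_le: "card (pal_pair k p q n) \<le> k ^ n"
  unfolding card_tuples[symmetric] by (rule card_mono) (auto simp: pal_pair_def)

text \<open>
  Removing the first and the last symbol shortens both palindromes symmetrically, and nothing is
  lost: the prefix reflection sends position \<open>0\<close> to a remaining position because \<open>p \<ge> 1\<close>, and the
  suffix reflection recovers the last symbol.
\<close>

lemma card_pal_pair_strip:
  assumes "1 \<le> p" "p \<le> n" "q \<le> n"
  shows "card (pal_pair k p q (n + 2)) \<le> card (pal_pair k p q n)"
proof (rule card_inj_on_le)
  let ?f = "\<lambda>u :: nat list. butlast (tl u)"
  have first: "u ! 0 = u ! (n + 1 - p)" and last: "u ! (n + 1) = u ! q"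
    if "u \<in> pal_pair k p q (n + 2)" for u
  proof -
    have len: "length u = n + 2" and pre: "palindrome (take (n + 2 - p) u)"
      and suf: "palindrome (drop q u)"
      using that by (auto simp: pal_pair_def tuples_def)
    show "u ! 0 = u ! (n + 1 - p)"
      using palindrome_nth[OF pre, of 0] len assms by simp
    show "u ! (n + 1) = u ! q"
      using palindrome_nth[OF suf, of 0] len assms by simp
  qed
  show "inj_on ?f (pal_pair k p q (n + 2))"
  proof (rule inj_onI)
    fix u v assume u: "u \<in> pal_pair k p q (n + 2)" and v: "v \<in> pal_pair k p q (n + 2)"
      and eq: "?f u = ?f v"
    have len: "length u = n + 2" "length v = n + 2"
      using u v by (auto simp: pal_pair_def tuples_def)
    have mid: "u ! Suc i = v ! Suc i" if "i < n" for i
    proof -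
      have "?f u ! i = ?f v ! i" using eq by simp
      then show ?thesis using that len by (simp add: nth_butlast nth_tl)
    qed
    have inner: "u ! i = v ! i" if "0 < i" "i \<le> n" for i
      using mid[of "i - 1"] that by simp
    have zero: "u ! 0 = v ! 0"
      using first[OF u] first[OF v] inner[of "n + 1 - p"] assms by simp
    \<comment> \<open>For \<open>q = 0\<close> the last symbol is the mirror image of the first one, not of an inner one.\<close>
    have final: "u ! (n + 1) = v ! (n + 1)"
      using last[OF u] last[OF v] inner[of q] zero assms by (cases "q = 0") auto
    have "u ! i = v ! i" if "i < n + 2" for i
    proof -
      have "i = 0 \<or> (0 < i \<and> i \<le> n) \<or> i = n + 1" using that by linarith
      then show ?thesis using inner zero final by blast
    qed
    then show "u = v" using len by (simp add: list_eq_iff_nth_eq)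
  qed
  show "?f ` pal_pair k p q (n + 2) \<subseteq> pal_pair k p q n"
  proof
    fix v assume "v \<in> ?f ` pal_pair k p q (n + 2)"
    then obtain u where u: "u \<in> pal_pair k p q (n + 2)" and v: "v = ?f u" by blast
    have len: "length u = n + 2" using u by (auto simp: pal_pair_def tuples_def)
    then obtain x w where xw: "u = x # w" "length w = Suc n" by (auto simp: length_Suc_conv)
    then obtain y where y: "u = x # v @ [y]" "length v = n"
      using v by (metis append_butlast_last_id length_0_conv length_butlast list.sel(3) nat.distinct(1) diff_Suc_1)
    have pre: "palindrome (take (n + 2 - p) u)" and suf: "palindrome (drop q u)"
      using u by (auto simp: pal_pair_def)
    have "palindrome (take (n - p) v)"
    proof -
      have "take (n + 2 - p) u = x # take (n + 1 - p) v"
        using y assms by (simp add: Suc_diff_le)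
      also have "\<dots> = x # take (n - p) v @ [v ! (n - p)]"
        using y assms by (simp add: Suc_diff_le take_Suc_conv_app_nth)
      finally show ?thesis using pre by (simp add: palindrome_Cons_snoc)
    qed
    moreover have "palindrome (drop q v)"
    proof (cases q)
      case 0
      then show ?thesis using suf y by (simp add: palindrome_Cons_snoc)
    next
      case (Suc r)
      then have "drop q u = v ! r # drop q v @ [y]"
        using y assms by (simp add: Cons_nth_drop_Suc flip: append_Cons)
      then show ?thesis using suf by (simp add: palindrome_Cons_snoc)
    qed
    moreover have "v \<in> tuples k n" using u y by (auto simp: pal_pair_def tuples_def)
    ultimately show "v \<in> pal_pair k p q n" by (simp add: pal_pair_def)
  qed
qed simp

lemma card_pal_pair_iterate:
  assumes "1 \<le> p" "p \<le> b" "q \<le> b"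
  shows "card (pal_pair k p q (b + 2 * j)) \<le> card (pal_pair k p q b)"
proof (induction j)
  case (Suc j)
  have "card (pal_pair k p q (b + 2 * j + 2)) \<le> card (pal_pair k p q (b + 2 * j))"
    using assms by (intro card_pal_pair_strip) auto
  with Suc show ?case by (simp add: algebra_simps)
qed simp

lemma palindrome_short [simp]: "palindrome []" "palindrome [a]"
  by (auto simp: palindrome_def)

text \<open>
  Stripping reduces these counts to the tuples of length 1 or 3 (for odd \<open>n\<close>) and of length 2 (for
  even \<open>n\<close>).
\<close>

lemma card_pal_pair_odd:
  assumes "odd n"
  shows "n \<ge> 3 \<Longrightarrow> card (pal_pair k 2 2 n) \<le> k ^ 3"
    and "n \<ge> 3 \<Longrightarrow> card (pal_pair k 2 1 n) \<le> k ^ 2"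
    and "card (pal_pair k 1 1 n) \<le> k"
    and "n \<ge> 3 \<Longrightarrow> card (pal_pair k 2 0 n) \<le> k ^ 2"
proof -
  obtain j where j: "n = 1 + 2 * j" using assms by (elim oddE) simp
  show "card (pal_pair k 1 1 n) \<le> k"
    using card_pal_pair_iterate[of 1 1 1 k j] card_pal_pair_le[of k 1 1 1] j by simp
  {
    assume "n \<ge> 3"
    then have n: "n = 3 + 2 * (j - 1)" using j by simp
    show "card (pal_pair k 2 2 n) \<le> k ^ 3"
      using card_pal_pair_iterate[of 2 3 2 k "j - 1"] card_pal_pair_le[of k 2 2 3] n by simp
    have "card (pal_pair k 2 0 3) \<le> card {u \<in> tuples k 3. palindrome u}"
      by (intro card_mono) (auto simp: pal_pair_def)
    then show "card (pal_pair k 2 0 n) \<le> k ^ 2"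
      using card_pal_pair_iterate[of 2 3 0 k "j - 1"] card_palindromes[of k 3] n by simp
    have "pal_pair k 2 1 3 \<subseteq> (\<lambda>(a, b). [a, b, b]) ` ({..<k} \<times> {..<k})"
    proof
      fix u assume u: "u \<in> pal_pair k 2 1 3"
      then have "length u = Suc (Suc (Suc 0))" by (simp add: pal_pair_def tuples_def)
      then have "\<exists>a b c. u = [a, b, c]" unfolding length_Suc_conv length_0_conv by blast
      then obtain a b c where "u = [a, b, c]" by blast
      moreover from this have "b = c"
        using u palindrome_Cons_snoc[of b "[]" c] by (simp add: pal_pair_def)
      ultimately have "u = [a, b, b]" "a < k" "b < k"
        using u by (simp_all add: pal_pair_def tuples_def)
      then show "u \<in> (\<lambda>(a, b). [a, b, b]) ` ({..<k} \<times> {..<k})"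
        by (intro image_eqI[of _ _ "(a, b)"]) simp_all
    qed
    then have "card (pal_pair k 2 1 3) \<le> card ({..<k} \<times> {..<k})"
      by (intro surj_card_le[of _ _ "\<lambda>(a, b). [a, b, b]"]) simp_all
    then show "card (pal_pair k 2 1 n) \<le> k ^ 2"
      using card_pal_pair_iterate[of 2 3 1 k "j - 1"] n by (simp add: power2_eq_square)
  }
qed

lemma card_pal_pair_even:
  assumes "even n" "n \<ge> 2"
  shows "card (pal_pair k 2 2 n) \<le> k ^ 2"
    and "card (pal_pair k 2 1 n) \<le> k ^ 2"
    and "card (pal_pair k 1 1 n) \<le> k ^ 2"
    and "card (pal_pair k 2 0 n) \<le> k"
proof -
  obtain j where "n = 2 * j" using assms by blast
  then have n: "n = 2 + 2 * (j - 1)" using assms by simp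
  have *: "card (pal_pair k p q n) \<le> k ^ 2" if "1 \<le> p" "p \<le> 2" "q \<le> 2" for p q
    using card_pal_pair_iterate[of p 2 q k "j - 1"] card_pal_pair_le[of k p q 2] n that by simp
  show "card (pal_pair k 2 2 n) \<le> k ^ 2" "card (pal_pair k 2 1 n) \<le> k ^ 2"
    "card (pal_pair k 1 1 n) \<le> k ^ 2" using * by simp_all
  have "card (pal_pair k 2 0 2) \<le> card {u \<in> tuples k 2. palindrome u}"
    by (intro card_mono) (auto simp: pal_pair_def)
  then show "card (pal_pair k 2 0 n) \<le> k"
    using card_pal_pair_iterate[of 2 2 0 k "j - 1"] card_palindromes[of k 2] n by simp
qed

lemma card_pal_pair_swap:
  "card (pal_pair k q p n) = card (pal_pair k p q n)"
proof -
  have "drop (length u - (length u - q)) u = drop q u" for u :: "nat list" and q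
    by (cases "q \<le> length u") simp_all
  then have "rev ` pal_pair k p q n \<subseteq> pal_pair k q p n" for p q
    by (auto simp: pal_pair_def tuples_def take_rev drop_rev)
  then have "card (pal_pair k p q n) \<le> card (pal_pair k q p n)" for p q
    by (intro card_inj_on_le[of rev]) auto
  then show ?thesis by (meson antisym)
qed

section \<open>The edge set of an orientable sequence and its reverse\<close>

text \<open>
  A window starting in \<open>v\<close> contributes to \<open>N v\<close>.  A reversed window starts in \<open>v\<close> if and only if
  the window ends in \<^term>\<open>rev v\<close>, that is, if and only if the next window starts in
  \<^term>\<open>rev v\<close>; by periodicity this happens \<open>N (rev v)\<close> times.
\<close>

lemma orientable_sequence_edge_set:
  assumes "orientable_sequence k n m S" and "n \<ge> 2"
  obtains E N where "E \<subseteq> tuples k n" and "\<And>u. rev u \<in> E \<longleftrightarrow> u \<in> E"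
    and "\<And>u. u \<in> E \<Longrightarrow> \<not> palindrome u" and "card E = 2 * m"
    and "\<And>v. card {u \<in> E. butlast u = v} = N v + N (rev v)"
proof -
  let ?w = "window n S"
  let ?v = "window (n - 1) S"
  have over: "S i < k" and per: "S (i + m) = S i" for i
    using assms unfolding orientable_sequence_def window_sequence_def seq_over_def has_period_def
    by blast+
  have cong: "?w i = ?w j \<Longrightarrow> [i = j] (mod m)" and orient: "?w i \<noteq> rev (?w j)" for i j
    using assms unfolding orientable_sequence_def window_sequence_def by blast+
  have len: "length (?w i) = n" for i by (simp add: window_def)
  have butlast_w: "butlast (?w i) = ?v i" for i
    using assms(2) by (auto simp: window_def list_eq_iff_nth_eq nth_butlast)
  have tl_w: "tl (?w i) = ?v (Suc i)" for i
    using assms(2) by (auto simp: window_def list_eq_iff_nth_eq nth_tl)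
  have v_per: "?v m = ?v 0"
    using per by (simp add: window_def list_eq_iff_nth_eq add.commute)
  have inj: "inj_on ?w {..<m}"
  proof (rule inj_onI)
    fix i j assume "i \<in> {..<m}" "j \<in> {..<m}" "?w i = ?w j"
    then show "i = j" using cong[of i j] by (simp add: cong_def)
  qed
  define A where "A = ?w ` {..<m}"
  define E where "E = A \<union> rev ` A"
  define N where "N v = card {i \<in> {..<m}. ?v i = v}" for v
  have fin: "finite A" by (simp add: A_def)
  have disj: "A \<inter> rev ` A = {}"
    using orient by (auto simp: A_def)
  have shift: "card {i \<in> {..<m}. ?v (Suc i) = v} = N v" for v
  proof -
    let ?g = "\<lambda>i. if ?v i = v then 1 else 0 :: nat"
    have "?g 0 + (\<Sum>i<m. ?g (Suc i)) = (\<Sum>i<m. ?g i) + ?g m"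
      using sum.lessThan_Suc[of ?g m] sum.lessThan_Suc_shift[of ?g m] by simp
    then have "(\<Sum>i<m. ?g (Suc i)) = (\<Sum>i<m. ?g i)" using v_per by simp
    then show ?thesis
      unfolding N_def card_eq_sum by (simp only: sum.inter_filter[OF finite_lessThan])
  qed
  have out_A: "card {u \<in> A. butlast u = v} = N v" for v
  proof -
    have "{u \<in> A. butlast u = v} = ?w ` {i \<in> {..<m}. ?v i = v}"
      by (auto simp: A_def butlast_w)
    moreover have "inj_on ?w {i \<in> {..<m}. ?v i = v}" using inj by (rule inj_on_subset) auto
    ultimately show ?thesis by (simp add: N_def card_image)
  qed
  have out_rev_A: "card {u \<in> rev ` A. butlast u = v} = N (rev v)" for v
  proof -
    have "{u \<in> rev ` A. butlast u = v} = (rev \<circ> ?w) ` {i \<in> {..<m}. ?v (Suc i) = rev v}"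
      by (auto simp: A_def butlast_rev tl_w rev_swap image_iff)
    moreover have "inj_on (rev \<circ> ?w) {i \<in> {..<m}. ?v (Suc i) = rev v}"
      using inj by (auto simp: inj_on_def)
    ultimately show ?thesis using shift[of "rev v"] by (simp only: card_image)
  qed
  show thesis
  proof (rule that[of E N])
    show "E \<subseteq> tuples k n"
      using over by (auto simp: E_def A_def tuples_def window_def)
    show "rev u \<in> E \<longleftrightarrow> u \<in> E" for u
      by (auto simp: E_def image_iff) (metis rev_rev_ident)+
    show "\<not> palindrome u" if "u \<in> E" for u
    proof -
      from that obtain i where "u = ?w i \<or> u = rev (?w i)" by (auto simp: E_def A_def)
      then show ?thesis using orient[of i i] by (auto simp: palindrome_def)
    qed
    have "card (rev ` A) = card A" by (simp add: card_image)
    moreover have "card A = m" using inj by (simp add: A_def card_image)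
    ultimately show "card E = 2 * m"
      unfolding E_def using disj fin by (simp add: card_Un_disjoint)
    show "card {u \<in> E. butlast u = v} = N v + N (rev v)" for v
    proof -
      have "{u \<in> E. butlast u = v} = {u \<in> A. butlast u = v} \<union> {u \<in> rev ` A. butlast u = v}"
        by (auto simp: E_def)
      then have "card {u \<in> E. butlast u = v}
          = card {u \<in> A. butlast u = v} + card {u \<in> rev ` A. butlast u = v}"
        using disj fin by (simp only:) (rule card_Un_disjoint; auto)
      then show ?thesis by (simp only: out_A out_rev_A)
    qed
  qed
qed

section \<open>Vertices with a forced unused edge\<close>

text \<open>
  The vertices \<open>w @ [x]\<close> with \<open>w\<close> a palindrome.  Those with a palindromic out-edge are left out:
  there the unused edge could be that palindrome, which is counted among the palindromes already.
\<close>

definition pal_then_symbol :: "nat \<Rightarrow> nat \<Rightarrow> nat list set" where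
  "pal_then_symbol k n =
     {v \<in> tuples k (n - 1). palindrome (butlast v) \<and> (\<forall>z. \<not> palindrome (v @ [z]))}"

text \<open>
  The palindromic vertices with an odd number of out-edges that are not palindromes.  This number
  is \<open>k - 1\<close> at a constant vertex and \<open>k\<close> at every other palindromic vertex.
\<close>

definition parity_vertices :: "nat \<Rightarrow> nat \<Rightarrow> nat list set" where
  "parity_vertices k n = {v \<in> tuples k (n - 1). palindrome v \<and> (uniform v \<longleftrightarrow> even k)}"

definition forced :: "nat \<Rightarrow> nat \<Rightarrow> nat list set" where
  "forced k n = pal_then_symbol k n \<union> parity_vertices k n"

lemma finite_forced:
  "finite (pal_then_symbol k n)" "finite (parity_vertices k n)" "finite (forced k n)"
proof -
  show "finite (pal_then_symbol k n)" "finite (parity_vertices k n)"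
    by (rule finite_subset[OF _ finite_tuples[of k "n - 1"]];
        force simp: pal_then_symbol_def parity_vertices_def)+
  then show "finite (forced k n)" by (simp add: forced_def)
qed

text \<open>
  There are \<open>k\<^bsup>(n + 1) div 2\<^esup>\<close> vertices \<open>w @ [x]\<close> with \<open>w\<close> a palindrome.  One of them is left out
  if and only if it extends to a palindrome; the extension is unique, since the new symbol repeats
  the first one, and it has a palindromic prefix of length \<open>n - 2\<close>.
\<close>

lemma card_pal_then_symbol:
  assumes "n \<ge> 2"
  shows "card (pal_then_symbol k n) + card (pal_pair k 2 0 n) = k ^ ((n + 1) div 2)"
proof -
  let ?V = "{v \<in> tuples k (n - 1). palindrome (butlast v)}"
  let ?P = "{w \<in> tuples k (n - 2). palindrome w}"
  let ?f = "\<lambda>(w, x). w @ [x :: nat]"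
  have "?V = ?f ` (?P \<times> {..<k})"
  proof (intro equalityI subsetI)
    fix v assume v: "v \<in> ?V"
    then have "v \<noteq> []" using assms by (auto simp: tuples_def)
    then obtain w x where "v = w @ [x]" by (metis append_butlast_last_id)
    then show "v \<in> ?f ` (?P \<times> {..<k})"
      using v assms by (auto simp: tuples_def image_iff)
  qed (use assms in \<open>auto simp: tuples_def\<close>)
  moreover have "inj_on ?f (?P \<times> {..<k})" by (auto simp: inj_on_def)
  ultimately have "card ?V = k ^ ((n - 2 + 1) div 2) * k"
    by (simp add: card_image card_cartesian_product card_palindromes)
  also have "\<dots> = k ^ Suc ((n - 2 + 1) div 2)" by simp
  also have "Suc ((n - 2 + 1) div 2) = (n + 1) div 2" using assms by simp
  finally have card_V: "card ?V = k ^ ((n + 1) div 2)" .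
  let ?X = "pal_pair k 2 0 n"
  have X: "length u = n" "palindrome u" "palindrome (take (n - 2) u)" "u \<in> tuples k n"
    if "u \<in> ?X" for u
    using that by (auto simp: pal_pair_def tuples_def)
  have last_hd: "last u = hd u" if "u \<in> ?X" for u
    using X[OF that] by (metis hd_rev palindrome_def)
  have "?V - pal_then_symbol k n = butlast ` ?X"
  proof (intro equalityI subsetI)
    fix v assume v: "v \<in> ?V - pal_then_symbol k n"
    then obtain z where z: "palindrome (v @ [z])" by (auto simp: pal_then_symbol_def)
    have lv: "length v = n - 1" using v by (simp add: tuples_def)
    have "z = hd (v @ [z])" using z by (metis hd_rev last_snoc palindrome_def)
    then have "z \<in> set v" using lv assms by (cases v) auto
    then have "v @ [z] \<in> tuples k n" using v assms by (auto simp: tuples_def)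
    then have "v @ [z] \<in> ?X"
      using z v lv by (simp add: pal_pair_def butlast_conv_take numeral_2_eq_2)
    then show "v \<in> butlast ` ?X" by force
  next
    fix v assume "v \<in> butlast ` ?X"
    then obtain u where u: "u \<in> ?X" "v = butlast u" by blast
    have "u \<noteq> []" using X[OF u(1)] assms by auto
    then have "u = v @ [last u]" using u by simp
    moreover have "butlast v = take (n - 2) u"
      using X[OF u(1)] u(2) assms by (simp add: butlast_conv_take min_def numeral_2_eq_2)
    moreover have "v \<in> tuples k (n - 1)"
      using X[OF u(1)] u(2) by (auto simp: tuples_def dest: in_set_butlastD)
    ultimately show "v \<in> ?V - pal_then_symbol k n"
      using X[OF u(1)] unfolding pal_then_symbol_def by auto metis
  qed
  moreover have "card (butlast ` ?X) = card ?X"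
  proof (rule card_image)
    show "inj_on butlast ?X"
    proof (rule inj_onI)
      fix u v assume u: "u \<in> ?X" and v: "v \<in> ?X" and eq: "butlast u = butlast v"
      have hd_butlast: "hd (butlast w) = hd w \<and> w \<noteq> []" if "length w = n" for w :: "nat list"
        using that assms by (cases w rule: remdups_adj.cases) auto
      have "hd u = hd v" "u \<noteq> []" "v \<noteq> []"
        using hd_butlast[of u] hd_butlast[of v] X(1)[OF u] X(1)[OF v] eq by auto
      then show "u = v" using eq last_hd[OF u] last_hd[OF v] by (metis append_butlast_last_id)
    qed
  qed
  moreover have "card (?V - pal_then_symbol k n) = card ?V - card (pal_then_symbol k n)"
    and "card (pal_then_symbol k n) \<le> card ?V"
  proof -
    have "pal_then_symbol k n \<subseteq> ?V" by (auto simp: pal_then_symbol_def)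
    then show "card (?V - pal_then_symbol k n) = card ?V - card (pal_then_symbol k n)"
      and "card (pal_then_symbol k n) \<le> card ?V"
      by (simp_all add: card_Diff_subset card_mono finite_forced)
  qed
  ultimately show ?thesis using card_V by simp
qed

lemma card_parity_vertices:
  assumes "n \<ge> 2"
  shows "even k \<Longrightarrow> card (parity_vertices k n) = k"
    and "odd k \<Longrightarrow> card (parity_vertices k n) + k = k ^ (n div 2)"
proof -
  show "card (parity_vertices k n) = k" if "even k"
  proof -
    have "parity_vertices k n = {v \<in> tuples k (n - 1). uniform v}"
      using that uniform_palindrome by (auto simp: parity_vertices_def)
    then show ?thesis using assms card_uniform[of "n - 1" k] by simp
  qed
  show "card (parity_vertices k n) + k = k ^ (n div 2)" if "odd k"
  proof -
    let ?P = "{v \<in> tuples k (n - 1). palindrome v}"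
    let ?U = "{v \<in> tuples k (n - 1). uniform v}"
    have "?U \<subseteq> ?P" using uniform_palindrome by auto
    moreover have "parity_vertices k n = ?P - ?U"
      using that by (auto simp: parity_vertices_def)
    ultimately have "card (parity_vertices k n) = card ?P - card ?U" "card ?U \<le> card ?P"
      by (simp_all add: card_Diff_subset card_mono)
    moreover have "card ?P = k ^ (n div 2)" "card ?U = k"
      using assms card_palindromes[of k "n - 1"] card_uniform[of "n - 1" k] by simp_all
    ultimately show ?thesis by simp
  qed
qed

text \<open>
  The two kinds of forced vertices are disjoint: a common vertex would be constant, and then its
  constant extension is a palindrome.
\<close>

lemma card_forced:
  assumes "n \<ge> 2"
  shows "card (forced k n) = card (pal_then_symbol k n) + card (parity_vertices k n)"
  unfolding forced_def
proof (rule card_Un_disjoint)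
  show "pal_then_symbol k n \<inter> parity_vertices k n = {}"
  proof (rule equals0I)
    fix v assume "v \<in> pal_then_symbol k n \<inter> parity_vertices k n"
    then have v: "palindrome v" "palindrome (butlast v)" "\<And>z. \<not> palindrome (v @ [z])" "length v = n - 1"
      by (auto simp: pal_then_symbol_def parity_vertices_def tuples_def)
    obtain a where a: "v = replicate (length v) a"
      using palindrome_butlast_uniform[OF v(1,2)] by (auto simp: uniform_def)
    have "palindrome (replicate l a @ [a])" for l
      by (simp add: palindrome_def replicate_append_same)
    then have "palindrome (v @ [a])" using a by metis
    then show False using v(3) by blast
  qed
qed (simp_all add: finite_forced)

lemma palindrome_snoc_uniform:
  assumes "uniform v" "palindrome (v @ [z])"
  shows "v = replicate (length v) z"
proof -
  obtain a where a: "v = replicate (length v) a" using assms by (auto simp: uniform_def)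
  show ?thesis
  proof (cases v)
    case (Cons b w)
    then have "b = z" using assms(2) by (simp add: palindrome_Cons_snoc)
    moreover have "b = a" using a Cons by simp
    ultimately show ?thesis using a by simp
  qed simp
qed

text \<open>
  Only the out-degree \<open>N v + N (rev v)\<close> matters: it is invariant under \<^const>\<open>rev\<close>, which settles
  the first kind of forced vertex, and even at palindromes, which settles the second.
\<close>

lemma forced_unused_edge:
  assumes "n \<ge> 2" and "E \<subseteq> tuples k n"
    and no_pal: "\<And>u. u \<in> E \<Longrightarrow> \<not> palindrome u"
    and out: "\<And>v. card {u \<in> E. butlast u = v} = N v + N (rev v)"
    and v: "v \<in> forced k n"
  shows "\<exists>u \<in> tuples k n. butlast u = v \<and> \<not> palindrome u \<and> u \<notin> E"
proof -
  define Z where "Z v = {z \<in> {..<k}. v @ [z] \<in> E}" for v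
  have Z: "card (Z v) = N v + N (rev v)" if "length v = n - 1" for v
  proof -
    have "{u \<in> E. butlast u = v} = (\<lambda>z. v @ [z]) ` Z v"
    proof (intro equalityI subsetI)
      fix u assume u: "u \<in> {u \<in> E. butlast u = v}"
      then have "length u = n" "set u \<subseteq> {..<k}" using assms by (auto simp: tuples_def)
      then have "u \<noteq> []" using assms by auto
      then have "u = v @ [last u]" "last u \<in> {..<k}"
        using u \<open>set u \<subseteq> {..<k}\<close> by (auto simp: subset_iff)
      then show "u \<in> (\<lambda>z. v @ [z]) ` Z v" using u by (auto simp: Z_def)
    qed (auto simp: Z_def)
    then have "card {u \<in> E. butlast u = v} = card (Z v)"
      by (simp add: card_image inj_on_def)
    then show ?thesis using out by simp
  qed
  have fin: "finite (Z v)" "Z v \<subseteq> {..<k}" for v by (auto simp: Z_def)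
  have len: "length v = n - 1" "v \<in> tuples k (n - 1)"
    using v by (auto simp: forced_def pal_then_symbol_def parity_vertices_def tuples_def)
  have "\<exists>z<k. z \<notin> Z v \<and> \<not> palindrome (v @ [z])"
  proof (cases "v \<in> pal_then_symbol k n")
    case True
    have "v \<noteq> []" using len True assms by (auto simp: pal_then_symbol_def)
    then obtain w x where w: "v = w @ [x]" by (metis append_butlast_last_id)
    \<comment> \<open>The palindrome \<open>x # w @ [x]\<close> keeps \<open>rev v\<close>, and hence \<open>v\<close>, from having full out-degree.\<close>
    have "palindrome (rev v @ [x])"
      using True w by (simp add: pal_then_symbol_def palindrome_Cons_snoc palindrome_def)
    then have "x \<notin> Z (rev v)" using no_pal by (auto simp: Z_def)
    moreover have "x < k" using len w by (auto simp: tuples_def)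
    ultimately have "Z (rev v) \<subset> {..<k}" using fin(2)[of "rev v"] by auto
    then have "card (Z (rev v)) < k" using psubset_card_mono[of "{..<k}"] by simp
    moreover have "card (Z (rev v)) = card (Z v)" using Z[of v] Z[of "rev v"] len by simp
    ultimately have "card (Z v) < k" by simp
    then have "Z v \<noteq> {..<k}" by (metis card_lessThan less_irrefl)
    then obtain z where "z < k" "z \<notin> Z v" using fin(2)[of v] by blast
    moreover have "\<not> palindrome (v @ [z])" using True by (simp add: pal_then_symbol_def)
    ultimately show ?thesis by blast
  next
    case False
    then have par: "palindrome v" "uniform v \<longleftrightarrow> even k"
      using v by (auto simp: forced_def parity_vertices_def)
    then have ev: "even (card (Z v))" using Z[of v] len by (simp add: palindrome_def)
    show ?thesis
    proof (cases "even k")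
      case False
      then have "Z v \<noteq> {..<k}" using ev by (metis card_lessThan)
      then obtain z where "z < k" "z \<notin> Z v" using fin(2)[of v] by blast
      moreover have "\<not> palindrome (v @ [z])"
        using par False palindrome_butlast_uniform[of "v @ [z]"] uniform_butlast[of "v @ [z]"] by auto
      ultimately show ?thesis by blast
    next
      case True
      then obtain a where a: "v = replicate (n - 1) a" using par len by (metis uniform_def)
      have "n - 1 > 0" using assms by simp
      then have "a < k" using a len by (auto simp: tuples_def)
      have "uniform (v @ [a])" using a by (auto simp: uniform_def replicate_append_same)
      then have "a \<notin> Z v" using no_pal uniform_palindrome by (auto simp: Z_def)
      then have "Z v \<subseteq> {..<k} - {a}" using fin(2)[of v] by auto
      moreover have "card ({..<k} - {a}) = k - 1" using \<open>a < k\<close> by simp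
      moreover have "odd (k - 1)" using True \<open>a < k\<close> by simp
      ultimately have "Z v \<subset> {..<k} - {a}" using ev by (metis psubsetI)
      then obtain z where z: "z < k" "z \<noteq> a" "z \<notin> Z v" by auto
      moreover have "\<not> palindrome (v @ [z])"
      proof
        assume "palindrome (v @ [z])"
        then have "v = replicate (n - 1) z" using palindrome_snoc_uniform par True len by metis
        then show False using a z(2) \<open>n - 1 > 0\<close> by (metis in_set_replicate neq0_conv)
      qed
      ultimately show ?thesis by blast
    qed
  qed
  then obtain z where z: "z < k" "z \<notin> Z v" "\<not> palindrome (v @ [z])" by blast
  then have "v @ [z] \<notin> E" by (simp add: Z_def)
  moreover have "v @ [z] \<in> tuples k n" using z(1) len assms(1) by (simp add: tuples_def)
  moreover have "butlast (v @ [z]) = v" by simp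
  ultimately show ?thesis using z(3) by blast
qed

text \<open>
  An edge \<open>u\<close> in this set may serve both as the unused edge at \<^term>\<open>butlast u\<close> and, reversed, as
  the one at \<^term>\<open>butlast (rev u)\<close>, so that two forced vertices together cost two edges, not four.
\<close>

definition doubly_forced :: "nat \<Rightarrow> nat \<Rightarrow> nat list set" where
  "doubly_forced k n =
     {u \<in> tuples k n. \<not> palindrome u \<and> butlast u \<in> forced k n \<and> butlast (rev u) \<in> forced k n}"

text \<open>
  With \<open>F\<close> the set of chosen unused edges, both bounds count \<open>F \<union> rev ` F\<close> outside \<open>E\<close> and outside
  the palindromes: the first one by \<open>|F|\<close>, the second one by inclusion and exclusion.
\<close>

lemma orientable_sequence_length_bounds:
  assumes "orientable_sequence k n m S" and "n \<ge> 2"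
  shows "2 * m + k ^ ((n + 1) div 2) + card (forced k n) \<le> k ^ n"
    and "2 * m + k ^ ((n + 1) div 2) + 2 * card (forced k n) \<le> k ^ n + card (doubly_forced k n)"
proof -
  obtain E N where E: "E \<subseteq> tuples k n" and rev_E: "\<And>u. rev u \<in> E \<longleftrightarrow> u \<in> E"
    and no_pal: "\<And>u. u \<in> E \<Longrightarrow> \<not> palindrome u" and card_E: "card E = 2 * m"
    and out: "\<And>v. card {u \<in> E. butlast u = v} = N v + N (rev v)"
    by (rule orientable_sequence_edge_set[OF assms]) (rule that)
  let ?P = "{u \<in> tuples k n. palindrome u}"
  let ?D = "forced k n"
  have "\<forall>v \<in> ?D. \<exists>u. u \<in> tuples k n \<and> butlast u = v \<and> \<not> palindrome u \<and> u \<notin> E"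
    using forced_unused_edge[OF assms(2) E no_pal out] by blast
  from bchoice[OF this] obtain f
    where f: "\<And>v. v \<in> ?D \<Longrightarrow>
      f v \<in> tuples k n \<and> butlast (f v) = v \<and> \<not> palindrome (f v) \<and> f v \<notin> E"
    by blast
  define F where "F = f ` ?D"
  have F: "u \<in> tuples k n \<and> butlast u \<in> ?D \<and> \<not> palindrome u \<and> u \<notin> E" if "u \<in> F" for u
    using that f by (auto simp: F_def)
  have "inj_on f ?D" using f by (metis inj_onI)
  then have card_F: "card F = card ?D" by (simp add: F_def card_image)
  have fin: "finite F" by (rule finite_subset[OF _ finite_tuples[of k n]]) (use F in auto)
  have fin_E: "finite E" using E by (rule finite_subset) simp
  have sub: "F \<union> rev ` F \<subseteq> tuples k n - ?P - E" using F rev_E by auto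
  have "card (tuples k n - ?P - E) = k ^ n - k ^ ((n + 1) div 2) - 2 * m"
    and "k ^ ((n + 1) div 2) + 2 * m \<le> k ^ n"
  proof -
    have "card (?P \<union> E) = k ^ ((n + 1) div 2) + 2 * m"
      using no_pal fin_E card_palindromes[of k n] card_E by (subst card_Un_disjoint) auto
    moreover have "?P \<union> E \<subseteq> tuples k n" using E by auto
    moreover have "tuples k n - ?P - E = tuples k n - (?P \<union> E)" by auto
    ultimately show "card (tuples k n - ?P - E) = k ^ n - k ^ ((n + 1) div 2) - 2 * m"
      and "k ^ ((n + 1) div 2) + 2 * m \<le> k ^ n"
      using card_Diff_subset[of "?P \<union> E" "tuples k n"] card_mono[of "tuples k n" "?P \<union> E"]
        fin_E card_tuples[of k n] by simp_all
  qed
  moreover have "card (F \<union> rev ` F) \<le> card (tuples k n - ?P - E)"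
    using sub by (intro card_mono) auto
  ultimately have bound: "2 * m + k ^ ((n + 1) div 2) + card (F \<union> rev ` F) \<le> k ^ n" by simp
  have "card F \<le> card (F \<union> rev ` F)" using fin by (intro card_mono) auto
  then show "2 * m + k ^ ((n + 1) div 2) + card ?D \<le> k ^ n" using bound card_F by simp
  have "card (F \<union> rev ` F) + card (F \<inter> rev ` F) = card F + card (rev ` F)"
    using fin card_Un_Int[of F "rev ` F"] by simp
  moreover have "card (rev ` F) = card F" by (simp add: card_image)
  moreover have "card (F \<inter> rev ` F) \<le> card (doubly_forced k n)"
  proof (rule card_mono)
    show "finite (doubly_forced k n)"
      by (rule finite_subset[OF _ finite_tuples[of k n]]) (auto simp: doubly_forced_def)
    show "F \<inter> rev ` F \<subseteq> doubly_forced k n"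
    proof
      fix u assume "u \<in> F \<inter> rev ` F"
      then have "u \<in> F" "rev u \<in> F" by auto
      then show "u \<in> doubly_forced k n" using F[of u] F[of "rev u"] by (simp add: doubly_forced_def)
    qed
  qed
  ultimately show "2 * m + k ^ ((n + 1) div 2) + 2 * card ?D \<le> k ^ n + card (doubly_forced k n)"
    using bound card_F by simp
qed


lemma forced_butlast:
  assumes "u \<in> tuples k n" "butlast u \<in> forced k n"
  shows "palindrome (take (n - 2) u) \<or> palindrome (take (n - 1) u)"
    and "even k \<Longrightarrow> palindrome (take (n - 2) u)"
proof -
  have u: "butlast u = take (n - 1) u" "butlast (butlast u) = take (n - 2) u"
    using assms(1) by (auto simp: tuples_def butlast_conv_take min_def numeral_2_eq_2)
  show "palindrome (take (n - 2) u) \<or> palindrome (take (n - 1) u)"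
    using assms(2) u
    by (auto simp: forced_def pal_then_symbol_def parity_vertices_def)
  show "palindrome (take (n - 2) u)" if "even k"
    using assms(2) that u uniform_palindrome[OF uniform_butlast[of "butlast u"]]
    by (auto simp: forced_def pal_then_symbol_def parity_vertices_def)
qed

text \<open>
  The smaller family consists of palindromes, whereas no doubly forced edge is a palindrome.  The
  inclusion lets its size be subtracted from the bound on the overlap.
\<close>

lemma pal_pair_2_0_subset:
  assumes "n \<ge> 2"
  shows "pal_pair k 2 0 n \<subseteq> pal_pair k 2 2 n"
proof
  fix u assume u: "u \<in> pal_pair k 2 0 n"
  then have "rev u = u" "length u = n" by (auto simp: pal_pair_def tuples_def palindrome_def)
  then have "rev (take (n - 2) u) = drop 2 u" using assms by (simp add: rev_take)
  moreover have "u \<in> tuples k n" "palindrome (take (n - 2) u)" using u by (auto simp: pal_pair_def)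
  ultimately show "u \<in> pal_pair k 2 2 n" by (metis (mono_tags) mem_Collect_eq pal_pair_def palindrome_rev)
qed

text \<open>
  For even \<open>k\<close> the palindromic forced vertices are constant, so they too have a palindromic prefix
  of length \<open>n - 2\<close>, and a single family covers the whole overlap.
\<close>

lemma card_doubly_forced_even:
  assumes "even k" "n \<ge> 2"
  shows "card (doubly_forced k n) + card (pal_pair k 2 0 n) \<le> card (pal_pair k 2 2 n)"
proof -
  have "doubly_forced k n \<subseteq> pal_pair k 2 2 n - pal_pair k 2 0 n"
  proof
    fix u assume u: "u \<in> doubly_forced k n"
    then have "u \<in> tuples k n" "palindrome (take (n - 2) u)" "palindrome (take (n - 2) (rev u))"
      using forced_butlast(2)[OF _ _ assms(1)] by (auto simp: doubly_forced_def)
    then show "u \<in> pal_pair k 2 2 n - pal_pair k 2 0 n"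
      using u assms(2) by (auto simp: pal_pair_def doubly_forced_def take_rev tuples_def)
  qed
  then have "card (doubly_forced k n) \<le> card (pal_pair k 2 2 n - pal_pair k 2 0 n)"
    by (intro card_mono) auto
  moreover have "card (pal_pair k 2 2 n - pal_pair k 2 0 n) + card (pal_pair k 2 0 n)
      = card (pal_pair k 2 2 n)"
    using pal_pair_2_0_subset[OF assms(2), of k] by (simp add: card_Diff_subset card_mono)
  ultimately show ?thesis by simp
qed

text \<open>
  The four families correspond to the kinds of \<^term>\<open>butlast u\<close> and \<^term>\<open>butlast (rev u)\<close>.  From
  each family some palindromes can be discarded: those of \<open>pal_pair k 2 0 n\<close> from the first, the
  \<open>k\<close> constant tuples from each of the other three.
\<close>

lemma card_doubly_forced:
  assumes "n \<ge> 2"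
  shows "card (doubly_forced k n) + card (pal_pair k 2 0 n) + 3 * k
    \<le> card (pal_pair k 2 2 n) + 2 * card (pal_pair k 2 1 n) + card (pal_pair k 1 1 n)"
proof -
  let ?X = "pal_pair k 2 0 n" and ?U = "{u \<in> tuples k n. uniform u}"
  let ?G = "\<lambda>p q. pal_pair k p q n"
  have "doubly_forced k n \<subseteq> (?G 2 2 - ?X) \<union> (?G 2 1 - ?U) \<union> (?G 1 2 - ?U) \<union> (?G 1 1 - ?U)"
  proof
    fix u assume u: "u \<in> doubly_forced k n"
    then have t: "u \<in> tuples k n" "length u = n" and np: "\<not> palindrome u"
      by (auto simp: doubly_forced_def tuples_def)
    have "palindrome (take (n - 2) u) \<or> palindrome (take (n - 1) u)"
      using forced_butlast(1)[of u k n] u by (simp add: doubly_forced_def)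
    moreover have "palindrome (drop 2 u) \<or> palindrome (drop 1 u)"
      using forced_butlast(1)[of "rev u" k n] u t assms by (simp add: doubly_forced_def take_rev)
    moreover have "u \<notin> ?X" "u \<notin> ?U"
      using np uniform_palindrome by (auto simp: pal_pair_def)
    ultimately show "u \<in> (?G 2 2 - ?X) \<union> (?G 2 1 - ?U) \<union> (?G 1 2 - ?U) \<union> (?G 1 1 - ?U)"
      using t(1) by (auto simp: pal_pair_def)
  qed
  then have "card (doubly_forced k n)
      \<le> card ((?G 2 2 - ?X) \<union> (?G 2 1 - ?U) \<union> (?G 1 2 - ?U) \<union> (?G 1 1 - ?U))"
    by (intro card_mono) auto
  also have "\<dots> \<le> card (?G 2 2 - ?X) + card (?G 2 1 - ?U) + card (?G 1 2 - ?U) + card (?G 1 1 - ?U)"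
    by (meson add_mono card_Un_le le_refl le_trans)
  finally have "card (doubly_forced k n)
      \<le> card (?G 2 2 - ?X) + card (?G 2 1 - ?U) + card (?G 1 2 - ?U) + card (?G 1 1 - ?U)" .
  moreover have "card (?G p q - ?U) + k = card (?G p q)" for p q
  proof -
    have "?U \<subseteq> ?G p q"
      using uniform_palindrome uniform_take uniform_drop by (fastforce simp: pal_pair_def)
    then have "card ?U \<le> card (?G p q)" "card (?G p q - ?U) = card (?G p q) - card ?U"
      by (simp_all add: card_mono card_Diff_subset)
    moreover have "card ?U = k" using assms by (simp add: card_uniform)
    ultimately show ?thesis by simp
  qed
  from this[of 2 1] this[of 1 2] this[of 1 1]
  have "card (?G 2 1 - ?U) + card (?G 1 2 - ?U) + card (?G 1 1 - ?U) + 3 * k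
      = 2 * card (?G 2 1) + card (?G 1 1)"
    using card_pal_pair_swap[of k 1 2 n] by simp
  moreover have "card (?G 2 2 - ?X) + card ?X = card (?G 2 2)"
    using pal_pair_2_0_subset[OF assms, of k] by (simp add: card_Diff_subset card_mono)
  ultimately show ?thesis by linarith
qed

text \<open>
  For \<open>n = 3\<close> every vertex \<open>[a, b]\<close> extends to the palindrome \<open>[a, b, a]\<close>, so only constant vertices
  are forced, and a 3-tuple between two of them is constant.
\<close>

lemma doubly_forced_three:
  assumes "even k"
  shows "doubly_forced k 3 = {}"
proof (rule equals0I)
  fix u assume u: "u \<in> doubly_forced k 3"
  have forced: "palindrome v" if "v \<in> forced k 3" for v
  proof (rule ccontr)
    assume "\<not> palindrome v"
    with that have v: "v \<in> pal_then_symbol k 3" by (auto simp: forced_def parity_vertices_def)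
    then have "length v = Suc (Suc 0)" by (simp add: pal_then_symbol_def tuples_def)
    then obtain a b where "v = [a, b]" by (metis length_0_conv length_Suc_conv)
    then have "palindrome (v @ [a])" by (simp add: palindrome_def)
    then show False using v by (simp add: pal_then_symbol_def)
  qed
  have "length u = Suc (Suc (Suc 0))" using u by (simp add: doubly_forced_def tuples_def)
  then have "\<exists>a b c. u = [a, b, c]" unfolding length_Suc_conv length_0_conv by blast
  then obtain a b c where abc: "u = [a, b, c]" by blast
  have "palindrome [a, b]" "palindrome [c, b]"
    using u forced abc by (force simp: doubly_forced_def)+
  then have "a = b" "c = b"
    using palindrome_Cons_snoc[of a "[]" b] palindrome_Cons_snoc[of c "[]" b] by simp_all
  then have "palindrome u" using abc by (simp add: palindrome_def)
  then show False using u by (simp add: doubly_forced_def)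
qed

section \<open>The length bounds\<close>

theorem theorem2p22:
  fixes k n m :: nat and S :: "nat \<Rightarrow> nat"
  assumes "k \<ge> 2" and "n \<ge> 2"
    and "orientable_sequence k n m S"
  shows
    "(n = 2 \<longrightarrow>
        (odd k \<longrightarrow> real m \<le> (real k ^ 2 - real k) / 2) \<and>
        (even k \<longrightarrow> real m \<le> (real k ^ 2 - 2 * real k) / 2)) \<and>
     (n = 3 \<longrightarrow>
        (odd k \<longrightarrow> real m \<le> (real k ^ 3 - real k ^ 2) / 2) \<and>
        (even k \<longrightarrow> real m \<le> (real k ^ 3 - real k ^ 2 - 2 * real k) / 2)) \<and>
     (n = 4 \<longrightarrow>
        (odd k \<longrightarrow> real m \<le> (real k ^ 4 - 3 * real k ^ 2 + 2 * real k) / 2) \<and>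
        (even k \<longrightarrow> real m \<le> (real k ^ 4 - 2 * real k ^ 2) / 2)) \<and>
     (n > 4 \<longrightarrow>
        (odd n \<and> odd k \<longrightarrow>
           real m \<le> (real k ^ n - 3 * real k ^ ((n + 1) div 2) - 2 * real k ^ ((n - 1) div 2)
                      + real k ^ 3 + 3 * real k ^ 2) / 2) \<and>
        (odd n \<and> even k \<longrightarrow>
           real m \<le> (real k ^ n - 3 * real k ^ ((n + 1) div 2)
                      + real k ^ 3 + real k ^ 2 - 2 * real k) / 2) \<and>
        (even n \<and> odd k \<longrightarrow>
           real m \<le> (real k ^ n - 5 * real k ^ (n div 2) + 4 * real k ^ 2) / 2) \<and>
        (even n \<and> even k \<longrightarrow>
           real m \<le> (real k ^ n - 3 * real k ^ (n div 2) + real k ^ 2 - real k) / 2))"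
proof -
  let ?K = "k ^ ((n + 1) div 2)" and ?X = "card (pal_pair k 2 0 n)" and ?D = "card (forced k n)"
  note single = orientable_sequence_length_bounds(1)[OF assms(3,2)]
  note double = orientable_sequence_length_bounds(2)[OF assms(3,2)]
  have D: "?D + ?X = ?K + card (parity_vertices k n)"
    using card_forced[OF assms(2), of k] card_pal_then_symbol[OF assms(2), of k] by simp
  have D_even: "?D + ?X = ?K + k" if "even k"
    using D card_parity_vertices(1)[OF assms(2) that] by simp
  have D_odd: "?D + ?X + k = ?K + k ^ (n div 2)" if "odd k"
    using D card_parity_vertices(2)[OF assms(2) that] by simp
  have X_even: "?X \<le> k" if "even n"
    using card_pal_pair_even(4)[OF that assms(2)] .
  have X_odd: "?X \<le> k ^ 2" if "odd n"
    using card_pal_pair_odd(4)[OF that] that assms(2) by (cases "n = 2") auto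

  have two_any: "2 * m + k \<le> k ^ 2" and two_even: "even k \<Longrightarrow> 2 * m + 2 * k \<le> k ^ 2" if "n = 2"
    using single D_even X_even that by auto
  have three_any: "2 * m + k ^ 2 \<le> k ^ 3" if "n = 3"
    using single that by simp
  have three_even: "2 * m + k ^ 2 + 2 * k \<le> k ^ 3" if "n = 3" "even k"
    using double D_even[OF that(2)] X_odd doubly_forced_three[OF that(2)] that(1) by simp
  have four_odd: "2 * m + 3 * k ^ 2 \<le> k ^ 4 + 2 * k" if "n = 4" "odd k"
    using single D_odd[OF that(2)] X_even that(1) by simp
  have four_even: "2 * m + 2 * k ^ 2 \<le> k ^ 4" if "n = 4" "even k"
    using single D_even[OF that(2)] X_even that(1) by simp
  have odd_odd: "2 * m + 3 * k ^ ((n + 1) div 2) + 2 * k ^ ((n - 1) div 2) \<le> k ^ n + k ^ 3 + 3 * k ^ 2"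
    if "n > 4" "odd n" "odd k"
  proof -
    have "(n - 1) div 2 = n div 2" using that(2) by (elim oddE) simp
    moreover have "card (doubly_forced k n) + ?X + 2 * k \<le> k ^ 3 + 2 * k ^ 2"
      using card_doubly_forced[OF assms(2), of k] card_pal_pair_odd[OF that(2), of k] that(1) by simp
    ultimately show ?thesis using double D_odd[OF that(3)] X_odd[OF that(2)] by simp
  qed
  have odd_even: "2 * m + 3 * k ^ ((n + 1) div 2) + 2 * k \<le> k ^ n + k ^ 3 + k ^ 2"
    if "n > 4" "odd n" "even k"
  proof -
    have "card (doubly_forced k n) + ?X \<le> k ^ 3"
      using card_doubly_forced_even[OF that(3) assms(2)] card_pal_pair_odd(1)[OF that(2), of k] that(1)
      by simp
    then show ?thesis using double D_even[OF that(3)] X_odd[OF that(2)] by simp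
  qed
  have even_odd: "2 * m + 5 * k ^ (n div 2) \<le> k ^ n + 4 * k ^ 2"
    if "n > 4" "even n" "odd k"
  proof -
    have "(n + 1) div 2 = n div 2" using that(2) by simp
    moreover have "card (doubly_forced k n) + ?X + 3 * k \<le> 4 * k ^ 2"
      using card_doubly_forced[OF assms(2), of k] card_pal_pair_even[OF that(2) assms(2), of k] by simp
    ultimately show ?thesis using double D_odd[OF that(3)] X_even[OF that(2)] by simp
  qed
  have even_even: "2 * m + 3 * k ^ (n div 2) + k \<le> k ^ n + k ^ 2"
    if "n > 4" "even n" "even k"
  proof -
    have "(n + 1) div 2 = n div 2" using that(2) by simp
    moreover have "card (doubly_forced k n) + ?X \<le> k ^ 2"
      using card_doubly_forced_even[OF that(3) assms(2)] card_pal_pair_even(1)[OF that(2) assms(2), of k]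
      by simp
    ultimately show ?thesis using double D_even[OF that(3)] X_even[OF that(2)] by simp
  qed

  \<comment> \<open>The bounds are rearranged over the reals, where subtraction is not truncated.\<close>
  note to_real = of_nat_le_iff[where 'a = real, THEN iffD2]
  show ?thesis
    by (intro conjI impI; (elim conjE)?)
      (use two_any[THEN to_real] two_even[THEN to_real] three_any[THEN to_real]
        three_even[THEN to_real] four_odd[THEN to_real] four_even[THEN to_real]
        odd_odd[THEN to_real] odd_even[THEN to_real] even_odd[THEN to_real] even_even[THEN to_real]
       in \<open>simp_all add: field_simps\<close>)
qed

end
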